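(* Let $F_0$ be a surface-knot, let $h_1,\dots,h_g\in P\backslash G(F_0)/P$ be 1-handles attached to $F_0$, let $m_1,n_1,\dots,m_g,n_g$ be integers, and let $(F,\Gamma)=\sum_{j=1}^g h_j(m_j,n_j)$ be the corresponding 2-dimensional braid with repeated pattern over $F=F_0+\sum_{j=1}^g h_j$. Let $m=\gcd_{1\le j\le g}\{m_j\}$ and assume $m\neq 0$. Then, by 1-handle moves, $(F,\Gamma)+1(0,0)$ is deformed to the form \[ \sum_{j=1}^g h_j(0,\tilde n_j)+h(m,n), \] where $h\in\langle h_1,\dots,h_g\rangle<(P\backslash G(F_0)/P)/H$ for the normal subgroup $H$ of $P\backslash G(F_0)/P$ generated by $h_ih_jh_i^{-1}h_j^{-1}$ $(i,j=1,\dots,g)$, $n=\frac{\sum_{j=1}^g m_jn_j}{m}$, and $\tilde n_1,\dots,\tilde n_g\in\{0,\dots,m-1\}$.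
   Context: Surface-knots and 2-dimensional braids. A surface-knot is the image of a smooth embedding of a connected closed oriented surface into $\mathbb{R}^4$. For a surface-knot $F$ let $N(F)=B^2\times F$ be a tubular neighbourhood with projection $p:N(F)\to F$. A 2-dimensional braid over $F$ of degree $N$ is a closed surface $S\subset N(F)$ such that $p|_S$ is a branched covering of degree $N$ and $S\cap p^{-1}(x)$ has $N$ or $N-1$ points for every $x\in F$. Two 2-dimensional braids are equivalent ($\sim$) if an ambient isotopy of $\mathbb{R}^4$ carries one to the other (and the underlying surface-knot to the underlying surface-knot) and is fiber-preserving on the tubular neighbourhood. The standard 2-dimensional braid over $F$ consists of $N$ parallel copies of $F$ obtained from parallel copies of a surface diagram of $F$ in $\mathbb{R}^3$; it determines the standard framing of $N(F)$, and is denoted $(F,\emptyset)$. Repeated pattern. Fix an $N$-braid $b$ (the pattern braid). A 2-dimensional braid over $F$ has repeated pattern if every closed path in $F$ presents a power of $b$ with respect to the standard framing. Such a braid, denoted $(F,\Gamma)$, where $\Gamma$ is a collection of bands of parallel oriented loops on $F$ each band presenting $b$, is determined by the integer exponents of $b$ on closed curves generating $H_1(F;\mathbb{Z})$. 1-handles. A 1-handle attached to $F_0$ is a 3-ball $h=B^2\times I$ embedded in $\mathbb{R}^4$ meeting $F_0$ exactly in $B^2\times\partial I$; it is assumed orientable and to have the framing whose projection to $\mathbb{R}^3$ is the blackboard framing. $F_0+h=(F_0-\mathrm{Int}B^2\times\partial I)\cup(\partial B^2\times I)$. The oriented core is $C=\{0\}\times I$. Let $G(F_0)=\pi_1(\mathbb{R}^4-\mathrm{Int}N(F_0),x)$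 with $x\in\partial N(F_0)$, and let $P$ be the image of $\pi_1(\partial N(F_0),x)$ in $G(F_0)$. Closing up $\overline{C}=\mathrm{cl}(C-N(F_0))$ by paths $\alpha,\beta$ in $\partial N(F_0)$ from $x$ to its initial and terminal points gives the loop $\alpha\overline{C}\beta^{-1}$ and an element of $P\backslash G(F_0)/P$, with which $h$ is identified. Products and inverses of 1-handles (e.g. $hh'$, $h^{-1}$), and subgroups generated by 1-handles, are formed using the loops in $G(F_0)$ representing the 1-handles; "$h\in\langle h_1,\dots,h_g\rangle$ modulo $H$" thus means that $h$ is a word in the $h_j^{\pm1}$, presented up to commutators of the $h_j$. A trivial 1-handle is one represented by $1$; it is denoted $1$. The core loop of $h$ is the projection of $\alpha\overline{C}\beta^{-1}$ to $F_0+h$, oriented as $C$; the cocore is $\partial B^2\times\{0\}$; their base point is their intersection point. Core loops of different 1-handles are taken disjoint. Notation. $h(m,n)$ denotes a 1-handle $h$ with chart loops such that the cocore presents $b^m$ and the core loop presents $b^n$. All 1-handles are attached to one fixed 2-disk in $F_0$ that contains no chart edges other than those of the 1-handles. $(F_0,\Gamma_0)+\sum_j h_j(m_j,n_j)$ denotes the resulting 2-dimensional braid over $F_0+\sum_j h_j$; $\sum_j h_j(m_j,n_j)$ means $(F_0,\emptyset)+\sum_j h_j(m_j,n_j)$. 1-handle moves are the following equivalences: $h(m,n)\sim h^{-1}(-m,-n)$; $h(m,n)\sim h(m,n\pm 2m)$; $1(m,n)\sim 1(-n,m)\sim 1(n,-m)$; $h(m,n)+h'(m',n')\sim hh'(m,n+n')+h'(m'-m,n')\sim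 h'^{-1}h(m,n-n')+h'(m'+m,n')$ (with the special cases $h(0,n)+h'(0,n')\sim hh'(0,n+n')+h'(0,n')\sim h'^{-1}h(0,n-n')+h'(0,n')$ and $h(m,n)+1(m',0)\sim h(m,n)+1(m'\pm m,0)$); $h(0,n)+h'(m',n')\sim h(0,n\pm m')+h'(m',n')$. *)

theory Defs
  imports
    "HOL-Analysis.Analysis"
    "HOL-Algebra.Generated_Groups"
    "HOL-Library.Multiset"
begin

section \<open>Surface-knots\<close>

text \<open>Intended for open \<open>S\<close>: by finite dimensionality, \<open>f\<close> is of class \<open>C\<^sup>k\<^sup>+\<^sup>1\<close>
  iff it is differentiable and all its directional derivatives are of class \<open>C\<^sup>k\<close>.\<close>

primrec Ck_on ::
  "nat \<Rightarrow> ('a::euclidean_space \<Rightarrow> 'b::euclidean_space) \<Rightarrow> 'a set \<Rightarrow> bool" where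
  "Ck_on 0 f S \<longleftrightarrow> continuous_on S f"
| "Ck_on (Suc k) f S \<longleftrightarrow>
     (\<exists>f'. (\<forall>x\<in>S. (f has_derivative f' x) (at x)) \<and> (\<forall>v. Ck_on k (\<lambda>x. f' x v) S))"

definition smooth_on ::
  "('a::euclidean_space \<Rightarrow> 'b::euclidean_space) \<Rightarrow> 'a set \<Rightarrow> bool" where
  "smooth_on f S \<longleftrightarrow> (\<forall>k. Ck_on k f S)"

text \<open>\<open>\<phi>\<close> on \<open>U\<close> is a smooth local parametrization of \<open>F\<close>: an immersion that is a
  homeomorphism onto a relatively open piece of \<open>F\<close>.\<close>

definition surface_patch ::
  "(real^4) set \<Rightarrow> (real^2) set \<Rightarrow> (real^2 \<Rightarrow> real^4) \<Rightarrow> bool" where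
  "surface_patch F U \<phi> \<longleftrightarrow>
     open U \<and> smooth_on \<phi> U \<and> (\<forall>u\<in>U. inj (frechet_derivative \<phi> (at u))) \<and>
     openin (top_of_set F) (\<phi> ` U) \<and> (\<exists>\<psi>. homeomorphism U (\<phi> ` U) \<phi> \<psi>)"

text \<open>Where two patches overlap, the linear map \<open>L\<close> below is the derivative of the change of
  coordinates.\<close>

definition oriented_atlas ::
  "(real^4) set \<Rightarrow> ((real^2) set \<times> (real^2 \<Rightarrow> real^4)) set \<Rightarrow> bool" where
  "oriented_atlas F A \<longleftrightarrow>
     (\<forall>(U, \<phi>)\<in>A. surface_patch F U \<phi>) \<and>
     F = (\<Union>(U, \<phi>)\<in>A. \<phi> ` U) \<and>
     (\<forall>(U, \<phi>)\<in>A. \<forall>(V, \<psi>)\<in>A. \<forall>u\<in>U. \<forall>v\<in>V. \<phi> u = \<psi> v \<longrightarrow>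
        (\<exists>L :: real^2 \<Rightarrow> real^2. linear L \<and> 0 < det (matrix L) \<and>
           frechet_derivative \<phi> (at u) = frechet_derivative \<psi> (at v) \<circ> L))"

definition surface_knot :: "(real^4) set \<Rightarrow> bool" where
  "surface_knot F \<longleftrightarrow> F \<noteq> {} \<and> compact F \<and> connected F \<and> (\<exists>A. oriented_atlas F A)"

text \<open>A framed tubular neighbourhood \<open>N(F) = B\<^sup>2 \<times> F\<close>, given by a map \<open>\<Phi>\<close> that is a smooth
  embedding on a slightly larger open disk bundle; \<open>B\<^sup>2\<close> is the closed unit disk.\<close>

definition tubular_framing :: "(real^4) set \<Rightarrow> ((real^2) \<times> (real^4) \<Rightarrow> real^4) \<Rightarrow> bool" where
  "tubular_framing F \<Phi> \<longleftrightarrow>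
     (\<forall>y\<in>F. \<Phi> (0, y) = y) \<and>
     (\<exists>r>1. inj_on \<Phi> (ball 0 r \<times> F) \<and>
        (\<forall>U \<phi>. surface_patch F U \<phi> \<longrightarrow>
           smooth_on (\<lambda>(v, u). \<Phi> (v, \<phi> u)) (ball 0 r \<times> U) \<and>
           (\<forall>w \<in> ball 0 r \<times> U.
              inj (frechet_derivative (\<lambda>(v, u). \<Phi> (v, \<phi> u)) (at w)))))"

definition knot_exterior :: "((real^2) \<times> (real^4) \<Rightarrow> real^4) \<Rightarrow> (real^4) set \<Rightarrow> (real^4) set" where
  "knot_exterior \<Phi> F = - \<Phi> ` (ball 0 1 \<times> F)"

definition tube_boundary :: "((real^2) \<times> (real^4) \<Rightarrow> real^4) \<Rightarrow> (real^4) set \<Rightarrow> (real^4) set" where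
  "tube_boundary \<Phi> F = \<Phi> ` (sphere 0 1 \<times> F)"


section \<open>Fundamental groups, the knot group and 1-handles\<close>

definition loops_at :: "'a::real_normed_vector set \<Rightarrow> 'a \<Rightarrow> (real \<Rightarrow> 'a) set" where
  "loops_at X x =
     {p. path p \<and> path_image p \<subseteq> X \<and> pathstart p = x \<and> pathfinish p = x}"

definition loop_class :: "'a::real_normed_vector set \<Rightarrow> (real \<Rightarrow> 'a) \<Rightarrow> (real \<Rightarrow> 'a) set" where
  "loop_class X p = Collect (homotopic_paths X p)"

definition fundamental_group ::
  "'a::real_normed_vector set \<Rightarrow> 'a \<Rightarrow> (real \<Rightarrow> 'a) set monoid" where
  "fundamental_group X x =
     \<lparr>carrier = loop_class X ` loops_at X x,
      mult = (\<lambda>a b. \<Union>p\<in>a. \<Union>q\<in>b. loop_class X (p +++ q)),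
      one = loop_class X (linepath x x)\<rparr>"

type_synonym knot_group_element = "(real \<Rightarrow> real^4) set"

definition knot_group ::
  "((real^2) \<times> (real^4) \<Rightarrow> real^4) \<Rightarrow> (real^4) set \<Rightarrow> real^4 \<Rightarrow> knot_group_element monoid" where
  "knot_group \<Phi> F x = fundamental_group (knot_exterior \<Phi> F) x"

text \<open>The image of the fundamental group of the boundary of the tube in the knot group.\<close>

definition peripheral_subgroup ::
  "((real^2) \<times> (real^4) \<Rightarrow> real^4) \<Rightarrow> (real^4) set \<Rightarrow> real^4 \<Rightarrow> knot_group_element set" where
  "peripheral_subgroup \<Phi> F x =
     loop_class (knot_exterior \<Phi> F) ` loops_at (tube_boundary \<Phi> F) x"

text \<open>The double coset space \<open>P\G/P\<close>. Its elements are the 1-handles; the elements of a double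
  coset are the loops \<open>\<alpha>C\<beta>\<^sup>-\<^sup>1\<close> representing the 1-handle, for the various choices of
  the paths \<open>\<alpha>\<close>, \<open>\<beta>\<close> in the boundary of the tube.\<close>

definition double_cosets :: "('a, 'b) monoid_scheme \<Rightarrow> 'a set \<Rightarrow> 'a set set" where
  "double_cosets G P = (\<lambda>a. P <#>\<^bsub>G\<^esub> (a <#\<^bsub>G\<^esub> P)) ` carrier G"

definition normal_closure :: "('a, 'b) monoid_scheme \<Rightarrow> 'a set \<Rightarrow> 'a set" where
  "normal_closure G S = \<Inter>{N. N \<lhd> G \<and> S \<subseteq> N}"


section \<open>1-handles with chart loops and 1-handle moves\<close>

text \<open>\<open>Handle h m n\<close> is the 1-handle \<open>h(m,n)\<close>, where \<open>h\<close> is a loop representing the 1-handle: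
  the cocore presents \<open>b\<^sup>m\<close> and the core loop presents \<open>b\<^sup>n\<close>, for the pattern braid \<open>b\<close>.
  A multiset of such 1-handles stands for the 2-dimensional braid
  \<open>(F\<^sub>0,\<emptyset>) + \<Sum>\<^sub>j h\<^sub>j(m\<^sub>j,n\<^sub>j)\<close> with repeated pattern.

  A representing loop is carried along because products and inverses of 1-handles are formed in
  the knot group and are not well defined on double cosets.\<close>

datatype 'a chart_handle = Handle (core: 'a) (cocore_exp: int) (core_exp: int)

inductive handle_move ::
  "('a, 'b) monoid_scheme \<Rightarrow> 'a chart_handle multiset \<Rightarrow> 'a chart_handle multiset \<Rightarrow> bool"
  for G (structure) where
  invert: "h \<in> carrier G \<Longrightarrow>
    handle_move G {#Handle h m n#} {#Handle (inv h) (-m) (-n)#}"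
| twist_plus: "h \<in> carrier G \<Longrightarrow>
    handle_move G {#Handle h m n#} {#Handle h m (n + 2 * m)#}"
| twist_minus: "h \<in> carrier G \<Longrightarrow>
    handle_move G {#Handle h m n#} {#Handle h m (n - 2 * m)#}"
| rotate_left: "handle_move G {#Handle \<one> m n#} {#Handle \<one> (-n) m#}"
| rotate_right: "handle_move G {#Handle \<one> m n#} {#Handle \<one> n (-m)#}"
| slide: "h \<in> carrier G \<Longrightarrow> h' \<in> carrier G \<Longrightarrow>
    handle_move G {#Handle h m n, Handle h' m' n'#}
      {#Handle (h \<otimes> h') m (n + n'), Handle h' (m' - m) n'#}"
| slide_back: "h \<in> carrier G \<Longrightarrow> h' \<in> carrier G \<Longrightarrow>
    handle_move G {#Handle h m n, Handle h' m' n'#}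
      {#Handle (inv h' \<otimes> h) m (n - n'), Handle h' (m' + m) n'#}"
| add_cocore: "h \<in> carrier G \<Longrightarrow> h' \<in> carrier G \<Longrightarrow>
    handle_move G {#Handle h 0 n, Handle h' m' n'#} {#Handle h 0 (n + m'), Handle h' m' n'#}"
| sub_cocore: "h \<in> carrier G \<Longrightarrow> h' \<in> carrier G \<Longrightarrow>
    handle_move G {#Handle h 0 n, Handle h' m' n'#} {#Handle h 0 (n - m'), Handle h' m' n'#}"

text \<open>A move on one or two of the 1-handles, the others being left unchanged.\<close>

definition handle_move_step ::
  "('a, 'b) monoid_scheme \<Rightarrow> 'a chart_handle multiset \<Rightarrow> 'a chart_handle multiset \<Rightarrow> bool" where
  "handle_move_step G X Y \<longleftrightarrow> (\<exists>A B R. X = A + R \<and> Y = B + R \<and> handle_move G A B)"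

text \<open>The moves are equivalences, so they may be applied in both directions.\<close>

definition deformed_by_handle_moves ::
  "('a, 'b) monoid_scheme \<Rightarrow> 'a chart_handle multiset \<Rightarrow> 'a chart_handle multiset \<Rightarrow> bool" where
  "deformed_by_handle_moves G = equivclp (handle_move_step G)"

end

theory Submission
  imports Defs
begin

text \<open>The extra 1-handle \<open>1(0,0)\<close> is represented by the trivial loop and has core exponent 0, so
  sliding \<open>h\<^sub>j\<close> over it alters neither the loop nor the exponents of \<open>h\<^sub>j\<close>, but changes the cocore
  exponent of the extra 1-handle by \<open>\<plusminus>m\<^sub>j\<close>. By Bezout it becomes \<open>1(d,0)\<close>. Sliding it now
  \<open>m\<^sub>j/d\<close> times over each \<open>h\<^sub>j\<close> turns the latter into \<open>h\<^sub>j(0,n\<^sub>j)\<close>, while the loop of the extra 1-handle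
  accumulates the factor \<open>h\<^sub>j\<close> to the power \<open>m\<^sub>j/d\<close> and its core exponent the summand \<open>(m\<^sub>j/d) n\<^sub>j\<close>.
  Finally its cocore exponent \<open>d\<close> reduces every \<open>n\<^sub>j\<close> modulo \<open>d\<close>. No twist \<open>h(m,n) \<sim> h(m,n \<plusminus> 2m)\<close>
  is used, which is why the final core exponent is exact.\<close>

subsection \<open>The fundamental group\<close>

text \<open>\<open>homotopic_paths\<close> is reflexive only on paths inside \<open>X\<close>, and
  the class of any other \<open>p\<close> is empty. The hypothesis puts \<open>p\<close> into its
  own class.\<close>

lemma loop_class_eq_iff:
  assumes "p \<in> loops_at X x"
  shows "loop_class X p = loop_class X q \<longleftrightarrow> homotopic_paths X p q"
proof
  assume "loop_class X p = loop_class X q"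
  moreover have "p \<in> loop_class X p"
    using assms by (simp add: loop_class_def loops_at_def)
  ultimately show "homotopic_paths X p q"
    by (simp add: loop_class_def homotopic_paths_sym)
next
  assume "homotopic_paths X p q"
  then show "loop_class X p = loop_class X q"
    by (auto simp: loop_class_def intro: homotopic_paths_trans homotopic_paths_sym)
qed

lemma loops_at_join: "p \<in> loops_at X x \<Longrightarrow> q \<in> loops_at X x \<Longrightarrow> p +++ q \<in> loops_at X x"
  by (auto simp: loops_at_def path_image_join)

lemma loops_at_reversepath: "p \<in> loops_at X x \<Longrightarrow> reversepath p \<in> loops_at X x"
  by (simp add: loops_at_def)

lemma loops_at_linepath: "x \<in> X \<Longrightarrow> linepath x x \<in> loops_at X x"
  by (simp add: loops_at_def)

text \<open>The group product is a union over all representatives. Joining respects homotopy, so all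
  sets in this union coincide.\<close>

lemma loop_class_Un_join:
  assumes "p \<in> loops_at X x" "q \<in> loops_at X x"
  shows "(\<Union>p'\<in>loop_class X p. \<Union>q'\<in>loop_class X q. loop_class X (p' +++ q')) =
         loop_class X (p +++ q)"
proof -
  have "loop_class X (p' +++ q') = loop_class X (p +++ q)"
    if "p' \<in> loop_class X p" "q' \<in> loop_class X q" for p' q'
  proof -
    have "homotopic_paths X (p +++ q) (p' +++ q')"
      using that assms by (intro homotopic_paths_join) (auto simp: loop_class_def loops_at_def)
    then show ?thesis
      using loop_class_eq_iff[OF loops_at_join[OF assms]] by metis
  qed
  moreover have "p \<in> loop_class X p" "q \<in> loop_class X q"
    using assms by (simp_all add: loop_class_def loops_at_def)
  ultimately show ?thesis by blast
qed

lemma fundamental_group_mult: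
  "p \<in> loops_at X x \<Longrightarrow> q \<in> loops_at X x \<Longrightarrow>
   loop_class X p \<otimes>\<^bsub>fundamental_group X x\<^esub> loop_class X q = loop_class X (p +++ q)"
  by (simp add: fundamental_group_def loop_class_Un_join)

lemma fundamental_group_one: "\<one>\<^bsub>fundamental_group X x\<^esub> = loop_class X (linepath x x)"
  by (simp add: fundamental_group_def)

lemma fundamental_group_carrier:
  "carrier (fundamental_group X x) = loop_class X ` loops_at X x"
  by (simp add: fundamental_group_def)

lemma group_fundamental_group:
  assumes x: "x \<in> X"
  shows "group (fundamental_group X x)" (is "group ?G")
proof (rule groupI)
  fix a b assume "a \<in> carrier ?G" "b \<in> carrier ?G"
  then show "a \<otimes>\<^bsub>?G\<^esub> b \<in> carrier ?G"
    by (auto simp: fundamental_group_carrier fundamental_group_mult loops_at_join)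
next
  show "\<one>\<^bsub>?G\<^esub> \<in> carrier ?G"
    using x by (simp add: fundamental_group_carrier fundamental_group_one loops_at_linepath)
next
  fix a b c assume "a \<in> carrier ?G" "b \<in> carrier ?G" "c \<in> carrier ?G"
  then obtain p q r
    where abc: "a = loop_class X p" "b = loop_class X q" "c = loop_class X r"
      and pqr: "p \<in> loops_at X x" "q \<in> loops_at X x" "r \<in> loops_at X x"
    by (auto simp: fundamental_group_carrier)
  have "homotopic_paths X (p +++ (q +++ r)) ((p +++ q) +++ r)"
    using pqr by (intro homotopic_paths_assoc) (auto simp: loops_at_def)
  then have "loop_class X (p +++ (q +++ r)) = loop_class X ((p +++ q) +++ r)"
    using pqr by (subst loop_class_eq_iff) (auto intro: loops_at_join)
  then show "a \<otimes>\<^bsub>?G\<^esub> b \<otimes>\<^bsub>?G\<^esub> c = a \<otimes>\<^bsub>?G\<^esub> (b \<otimes>\<^bsub>?G\<^esub> c)"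
    using pqr by (simp add: abc fundamental_group_mult loops_at_join)
next
  fix a assume "a \<in> carrier ?G"
  then obtain p where a: "a = loop_class X p" and p: "p \<in> loops_at X x"
    by (auto simp: fundamental_group_carrier)
  have "homotopic_paths X (linepath x x +++ p) p"
    using p by (intro homotopic_paths_lid') (auto simp: loops_at_def)
  then show "\<one>\<^bsub>?G\<^esub> \<otimes>\<^bsub>?G\<^esub> a = a"
    using p x by (simp add: a fundamental_group_mult fundamental_group_one loops_at_linepath
        loops_at_join loop_class_eq_iff[of _ X x])
  have "homotopic_paths X (reversepath p +++ p) (linepath x x)"
    using p homotopic_paths_linv[of p X] by (simp add: loops_at_def)
  then have "loop_class X (reversepath p) \<otimes>\<^bsub>?G\<^esub> a = \<one>\<^bsub>?G\<^esub>"
    using p by (simp add: a fundamental_group_mult fundamental_group_one loops_at_reversepath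
        loops_at_join loop_class_eq_iff[of _ X x])
  then show "\<exists>b\<in>carrier ?G. b \<otimes>\<^bsub>?G\<^esub> a = \<one>\<^bsub>?G\<^esub>"
    using p by (auto simp: fundamental_group_carrier intro: loops_at_reversepath)
qed

section \<open>The boundary of the tube and the peripheral subgroup\<close>

lemma tube_boundary_subset_knot_exterior:
  assumes "tubular_framing F \<Phi>"
  shows "tube_boundary \<Phi> F \<subseteq> knot_exterior \<Phi> F"
proof
  fix y assume "y \<in> tube_boundary \<Phi> F"
  then obtain v z where y: "y = \<Phi> (v, z)" and v: "norm v = 1" and z: "z \<in> F"
    by (auto simp: tube_boundary_def)
  obtain r where r: "r > 1" and inj: "inj_on \<Phi> (ball 0 r \<times> F)"
    using assms by (auto simp: tubular_framing_def)
  \<comment> \<open>As \<open>r > 1\<close>, injectivity covers the unit circle together with the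
    open disk, so their images cannot meet.\<close>
  have "\<Phi> (w, u) \<noteq> \<Phi> (v, z)" if "norm w < 1" "u \<in> F" for w u
    using inj_onD[OF inj, of "(w, u)" "(v, z)"] that r v z by auto
  then show "y \<in> knot_exterior \<Phi> F"
    by (force simp: y knot_exterior_def)
qed

lemma peripheral_subgroup_subset:
  assumes "tube_boundary \<Phi> F \<subseteq> knot_exterior \<Phi> F"
  shows "peripheral_subgroup \<Phi> F x \<subseteq> carrier (knot_group \<Phi> F x)"
  using assms
  by (auto simp: peripheral_subgroup_def knot_group_def fundamental_group_carrier loops_at_def)

lemma one_in_peripheral_subgroup:
  "x \<in> tube_boundary \<Phi> F \<Longrightarrow> \<one>\<^bsub>knot_group \<Phi> F x\<^esub> \<in> peripheral_subgroup \<Phi> F x"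
  by (simp add: peripheral_subgroup_def knot_group_def fundamental_group_one loops_at_linepath)


subsection \<open>Double cosets and normal closures\<close>

context group
begin

lemma double_coset_subset_carrier:
  assumes "P \<subseteq> carrier G" "k \<in> double_cosets G P"
  shows "k \<subseteq> carrier G"
proof -
  obtain a where a: "a \<in> carrier G" and k: "k = P <#> (a <# P)"
    using assms(2) by (auto simp: double_cosets_def)
  show ?thesis
    unfolding k by (intro set_mult_closed l_coset_subset_G assms(1) a)
qed

lemma mem_own_double_coset:
  assumes "\<one> \<in> P" "a \<in> carrier G"
  shows "a \<in> P <#> (a <# P)"
proof -
  have "a = \<one> \<otimes> (a \<otimes> \<one>)" using assms(2) by simp
  then show ?thesis
    using assms(1) unfolding set_mult_def l_coset_def by blast
qed

lemma normal_Inter: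
  assumes "\<N> \<noteq> {}" "\<And>N. N \<in> \<N> \<Longrightarrow> N \<lhd> G"
  shows "\<Inter>\<N> \<lhd> G"
proof (rule normal_invI)
  show "subgroup (\<Inter>\<N>) G"
    using assms by (intro subgroups_Inter) (auto dest: normal_imp_subgroup)
  show "y \<otimes> a \<otimes> inv y \<in> \<Inter>\<N>" if "y \<in> carrier G" "a \<in> \<Inter>\<N>" for y a
    using that assms(2) normal_invE(2) by blast
qed

lemma normal_normal_closure:
  assumes "S \<subseteq> carrier G"
  shows "normal_closure G S \<lhd> G"
proof -
  \<comment> \<open>This normal subgroup contains \<open>S\<close>, so the family that is
    intersected is nonempty.\<close>
  have "carrier G \<lhd> G"
    by (simp add: normal_inv_iff subgroup_self)
  then show ?thesis
    unfolding normal_closure_def using assms by (intro normal_Inter) auto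
qed

text \<open>Reduction modulo \<open>N\<close> is a homomorphism and so carries generated subgroups
  to generated subgroups. It turns a word in the loops into a word modulo \<open>H\<close>.\<close>

lemma r_coset_in_generate_Mod:
  assumes N: "N \<lhd> G" and S: "S \<subseteq> carrier G" and a: "a \<in> generate G S"
  shows "N #> a \<in> generate (G Mod N) ((\<lambda>s. N #> s) ` S)"
proof -
  interpret group_hom G "G Mod N" "\<lambda>s. N #> s"
    using normal.r_coset_hom_Mod[OF N] normal.factorgroup_is_group[OF N]
    by (simp add: group_hom_def group_hom_axioms_def is_group)
  show ?thesis
    using generate_img[OF S] a by blast
qed

end


subsection \<open>Deformations by 1-handle moves\<close>

lemma deformed_refl: "deformed_by_handle_moves G X X"
  unfolding deformed_by_handle_moves_def by (rule reflpD) simp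

lemma deformed_sym: "deformed_by_handle_moves G X Y \<Longrightarrow> deformed_by_handle_moves G Y X"
  unfolding deformed_by_handle_moves_def by (rule equivclp_sym)

lemma deformed_trans [trans]:
  "deformed_by_handle_moves G X Y \<Longrightarrow> deformed_by_handle_moves G Y Z \<Longrightarrow>
   deformed_by_handle_moves G X Z"
  unfolding deformed_by_handle_moves_def by (rule transpD[OF transp_equivclp])

lemma handle_move_imp_deformed:
  "handle_move G A B \<Longrightarrow> deformed_by_handle_moves G A B"
  unfolding deformed_by_handle_moves_def handle_move_step_def
  by (rule r_into_equivclp) (metis add.right_neutral)

lemma handle_move_step_add:
  "handle_move_step G X Y \<Longrightarrow> handle_move_step G (X + R) (Y + R)"
  unfolding handle_move_step_def by (metis add.assoc)

text \<open>Additional handles are absorbed into the part that each move leaves unchanged.\<close>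

lemma deformed_add:
  assumes "deformed_by_handle_moves G X Y"
  shows "deformed_by_handle_moves G (X + R) (Y + R)"
  using assms unfolding deformed_by_handle_moves_def
proof (induction rule: equivclp_induct)
  case base
  then show ?case by (rule reflpD[OF reflp_equivclp])
next
  case (step Y Z)
  then show ?case
    by (meson equivclp_into_equivclp handle_move_step_add)
qed

text \<open>Reversing the steps reaches negative \<open>k\<close>. Integers are required since
  Bezout coefficients and quotients of exponents may be negative.\<close>

lemma deformed_int_steps:
  assumes step: "\<And>k. deformed_by_handle_moves G (X k) (X (k + 1))"
  shows "deformed_by_handle_moves G (X 0) (X (k :: int))"
proof (induction k rule: int_induct[where k = 0])
  case base
  show ?case by (rule deformed_refl)
next
  case (step1 i)
  then show ?case using step deformed_trans by blast
next
  case (step2 i)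
  then show ?case using step[of "i - 1"] deformed_sym deformed_trans by fastforce
qed

section \<open>Iterated moves, Bezout and the clearing of cocores\<close>

context group
begin

lemma trivial_handle_add_cocore:
  assumes "h \<in> carrier G"
  shows "deformed_by_handle_moves G
    {#Handle h m n, Handle \<one> a 0#} {#Handle h m n, Handle \<one> (a + k * m) 0#}"
proof -
  have "deformed_by_handle_moves G
      {#Handle h m n, Handle \<one> (a + i * m) 0#} {#Handle h m n, Handle \<one> (a + (i + 1) * m) 0#}"
    for i
    using handle_move_imp_deformed[OF slide_back[where G = G and h = h and h' = \<one> and m = m
          and n = n and m' = "a + i * m" and n' = 0]] assms
    by (simp add: algebra_simps)
  from deformed_int_steps[of G "\<lambda>i. {#Handle h m n, Handle \<one> (a + i * m) 0#}", OF this]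
  show ?thesis by simp
qed

text \<open>A slide leaves \<open>d\<close> and \<open>n\<close> unchanged and so can be repeated.
  Each one multiplies by \<open>h\<close> on the right, which builds up the power.\<close>

lemma slide_multiple:
  assumes "e \<in> carrier G" "h \<in> carrier G"
  shows "deformed_by_handle_moves G
    {#Handle e d b, Handle h m n#}
    {#Handle (e \<otimes> h [^] (k :: int)) d (b + k * n), Handle h (m - k * d) n#}"
proof -
  have "deformed_by_handle_moves G
      {#Handle (e \<otimes> h [^] i) d (b + i * n), Handle h (m - i * d) n#}
      {#Handle (e \<otimes> h [^] (i + 1)) d (b + (i + 1) * n), Handle h (m - (i + 1) * d) n#}"
    for i :: int
  proof -
    have pow: "h [^] (i + 1) = h [^] i \<otimes> h"
      using assms by (simp add: int_pow_mult)
    show ?thesis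
      using handle_move_imp_deformed[OF slide[where G = G and h = "e \<otimes> h [^] i" and h' = h
            and m = d and n = "b + i * n" and m' = "m - i * d" and n' = n]] assms
      by (simp add: pow distrib_right diff_diff_eq m_assoc add.assoc)
  qed
  from deformed_int_steps[of G "\<lambda>i. {#Handle (e \<otimes> h [^] i) d (b + i * n),
      Handle h (m - i * d) n#}", OF this]
  show ?thesis using assms by simp
qed

text \<open>The move requires cocore exponent 0 on \<open>h\<close>, so it becomes available once
  that cocore has been cleared. The second handle stays as it is.\<close>

lemma add_cocore_multiple:
  assumes "h \<in> carrier G" "e \<in> carrier G"
  shows "deformed_by_handle_moves G
    {#Handle h 0 n, Handle e d b#} {#Handle h 0 (n + k * d), Handle e d b#}"
proof -
  have "deformed_by_handle_moves G
      {#Handle h 0 (n + i * d), Handle e d b#} {#Handle h 0 (n + (i + 1) * d), Handle e d b#}"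
    for i
    using handle_move_imp_deformed[OF add_cocore[where G = G and h = h and h' = e
          and n = "n + i * d" and m' = d and n' = b]] assms
    by (simp add: algebra_simps)
  from deformed_int_steps[of G "\<lambda>i. {#Handle h 0 (n + i * d), Handle e d b#}", OF this]
  show ?thesis by simp
qed

text \<open>With Bezout coefficients \<open>u\<close>, \<open>v\<close> for \<open>m i\<close> and
  the gcd of the rest, \<open>t * u\<close> slides over the new handle and the induction hypothesis
  for \<open>t * v\<close> add up to \<open>t\<close> times the new gcd. Hence \<open>a\<close> and
  \<open>t\<close> are kept general.\<close>

lemma trivial_handle_add_Gcd:
  assumes "finite J" "\<And>j. j \<in> J \<Longrightarrow> h j \<in> carrier G"
  shows "deformed_by_handle_moves G
    ((\<Sum>j\<in>J. {#Handle (h j) (m j) (n j)#}) + {#Handle \<one> a 0#})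
    ((\<Sum>j\<in>J. {#Handle (h j) (m j) (n j)#}) + {#Handle \<one> (a + t * (GCD j\<in>J. m j)) 0#})"
  using assms
proof (induction J arbitrary: a t rule: finite_induct)
  case empty
  \<comment> \<open>The gcd of the empty family is 0, so nothing changes.\<close>
  show ?case by (simp add: deformed_refl)
next
  case (insert i J)
  let ?X = "\<Sum>j\<in>J. {#Handle (h j) (m j) (n j)#}" and ?H = "Handle (h i) (m i) (n i)"
  obtain u v where uv: "u * m i + v * (GCD j\<in>J. m j) = (GCD j\<in>insert i J. m j)"
    using bezout_int[of "m i" "GCD j\<in>J. m j"] by auto
  let ?a = "a + (t * u) * m i"
  have "deformed_by_handle_moves G ({#?H, Handle \<one> a 0#} + ?X) ({#?H, Handle \<one> ?a 0#} + ?X)"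
    using insert.prems by (intro deformed_add trivial_handle_add_cocore) simp
  also have "{#?H, Handle \<one> ?a 0#} + ?X = (?X + {#Handle \<one> ?a 0#}) + {#?H#}"
    by simp
  also have "deformed_by_handle_moves G \<dots>
      ((?X + {#Handle \<one> (?a + (t * v) * (GCD j\<in>J. m j)) 0#}) + {#?H#})"
    using insert.prems by (intro deformed_add insert.IH) simp
  also have "?a + (t * v) * (GCD j\<in>J. m j) = a + t * (GCD j\<in>insert i J. m j)"
    by (simp only: uv[symmetric]) (simp add: algebra_simps)
  finally show ?case
    using insert.hyps by (simp add: add_mset_commute)
qed

text \<open>The last handle collects a factor and a summand from each index, so \<open>e\<close> and
  \<open>b\<close> vary in the induction. The order of the factors follows the order of treatment,
  and only membership in the fixed subgroup \<open>S\<close> is recorded.\<close>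

lemma clear_cocores:
  assumes "finite J" "\<And>j. j \<in> J \<Longrightarrow> h j \<in> carrier G" "\<And>j. j \<in> J \<Longrightarrow> d dvd m j"
    and "subgroup S G" "h ` J \<subseteq> S" "e \<in> S"
  shows "\<exists>e'\<in>S. deformed_by_handle_moves G
    ((\<Sum>j\<in>J. {#Handle (h j) (m j) (n j)#}) + {#Handle e d b#})
    ((\<Sum>j\<in>J. {#Handle (h j) 0 (n j mod d)#}) + {#Handle e' d (b + (\<Sum>j\<in>J. m j div d * n j))#})"
  using assms
proof (induction J arbitrary: e b rule: finite_induct)
  case empty
  then show ?case by (auto intro: deformed_refl)
next
  case (insert i J)
  let ?X = "\<Sum>j\<in>J. {#Handle (h j) (m j) (n j)#}"
  let ?Y = "\<Sum>j\<in>J. {#Handle (h j) 0 (n j mod d)#}"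
  \<comment> \<open>Since \<open>d\<close> divides \<open>m i\<close>, exactly \<open>q\<close>
    slides bring the cocore exponent of \<open>h i\<close> to 0.\<close>
  define q where "q = m i div d"
  let ?e = "e \<otimes> h i [^] q" and ?b = "b + q * n i"
  have S: "e \<in> carrier G" "h i \<in> carrier G"
    using insert.prems(1,3,5) by (auto intro: subgroup.mem_carrier)
  have e_S: "?e \<in> S"
    using insert.prems(3-5)
    by (intro subgroup.m_closed[OF insert.prems(3)] subgroup_int_pow_closed) auto
  have e_carrier: "?e \<in> carrier G"
    using subgroup.mem_carrier[OF insert.prems(3) e_S] .
  have m: "m i - q * d = 0"
    using insert.prems(2) by (simp add: q_def)
  \<comment> \<open>The number of times the cocore exponent \<open>d\<close> is added to leave the
    remainder.\<close>
  have mod: "n i + (- (n i div d)) * d = n i mod d"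
    by (simp add: minus_div_mult_eq_mod)
  obtain e' where e': "e' \<in> S" and IH: "deformed_by_handle_moves G (?X + {#Handle ?e d ?b#})
      (?Y + {#Handle e' d (?b + (\<Sum>j\<in>J. m j div d * n j))#})"
    using insert.IH[of ?e ?b] insert.prems e_S by auto
  have "deformed_by_handle_moves G
      ({#Handle e d b, Handle (h i) (m i) (n i)#} + ?X)
      ({#Handle ?e d ?b, Handle (h i) 0 (n i)#} + ?X)"
    using slide_multiple[OF S(1,2), of d b "m i" "n i" q] unfolding m by (rule deformed_add)
  also have "{#Handle ?e d ?b, Handle (h i) 0 (n i)#} + ?X =
      {#Handle (h i) 0 (n i), Handle ?e d ?b#} + ?X"
    by (simp add: add_mset_commute)
  also have "deformed_by_handle_moves G \<dots>
      ({#Handle (h i) 0 (n i mod d), Handle ?e d ?b#} + ?X)"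
    using add_cocore_multiple[of "h i" ?e "n i" d ?b "- (n i div d)"] S e_carrier unfolding mod
    by (intro deformed_add) simp
  also have "\<dots> = (?X + {#Handle ?e d ?b#}) + {#Handle (h i) 0 (n i mod d)#}"
    by (simp add: add_mset_commute)
  also have "deformed_by_handle_moves G \<dots>
      ((?Y + {#Handle e' d (?b + (\<Sum>j\<in>J. m j div d * n j))#}) + {#Handle (h i) 0 (n i mod d)#})"
    using IH by (rule deformed_add)
  finally show ?case
    using insert.hyps e' by (auto simp: q_def add_mset_commute add.assoc)
qed

lemma deformed_to_gcd_handle:
  assumes J: "finite J" and h: "\<And>j. j \<in> J \<Longrightarrow> h j \<in> carrier G" and d: "d = (GCD j\<in>J. m j)"
  shows "\<exists>e\<in>generate G (h ` J). deformed_by_handle_moves G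
    ((\<Sum>j\<in>J. {#Handle (h j) (m j) (n j)#}) + {#Handle \<one> 0 0#})
    ((\<Sum>j\<in>J. {#Handle (h j) 0 (n j mod d)#}) + {#Handle e d ((\<Sum>j\<in>J. m j * n j) div d)#})"
proof -
  have dvd: "d dvd m j" if "j \<in> J" for j
    using that by (simp add: d)
  \<comment> \<open>Division by \<open>d\<close> is exact in each summand, so it commutes with the
    sum. For \<open>d = 0\<close> both sides are 0, as \<open>x div 0 = 0\<close>.\<close>
  have sum: "(\<Sum>j\<in>J. m j div d * n j) = (\<Sum>j\<in>J. m j * n j) div d"
  proof (cases "d = 0")
    case False
    have "(\<Sum>j\<in>J. m j * n j) = (\<Sum>j\<in>J. m j div d * n j) * d"
      using dvd by (auto simp: sum_distrib_right intro!: sum.cong)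
    then show ?thesis using False by simp
  qed simp
  have "deformed_by_handle_moves G
      ((\<Sum>j\<in>J. {#Handle (h j) (m j) (n j)#}) + {#Handle \<one> 0 0#})
      ((\<Sum>j\<in>J. {#Handle (h j) (m j) (n j)#}) + {#Handle \<one> d 0#})"
    using trivial_handle_add_Gcd[OF J, of h m n 0 1] h by (simp add: d)
  \<comment> \<open>The collection starts from the unit loop and core exponent 0, with
    \<open>S\<close> the subgroup generated by the loops.\<close>
  moreover have "\<exists>e\<in>generate G (h ` J). deformed_by_handle_moves G
      ((\<Sum>j\<in>J. {#Handle (h j) (m j) (n j)#}) + {#Handle \<one> d 0#})
      ((\<Sum>j\<in>J. {#Handle (h j) 0 (n j mod d)#}) +
        {#Handle e d (0 + (\<Sum>j\<in>J. m j div d * n j))#})"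
    using J h dvd
    by (intro clear_cocores generate_is_subgroup) (auto intro: generate.incl generate.one)
  ultimately show ?thesis
    using deformed_trans unfolding sum add_0 by blast
qed

end

section \<open>From an abstract group to the knot group of \<open>F\<^sub>0\<close>\<close>

theorem theorem1p3:
  fixes F\<^sub>0 :: "(real^4) set"
    and \<Phi> :: "(real^2) \<times> (real^4) \<Rightarrow> real^4"
    and x :: "real^4"
    and G :: "knot_group_element monoid"
    and P H :: "knot_group_element set"
    and g :: nat
    and h :: "nat \<Rightarrow> knot_group_element set"
    and \<gamma> :: "nat \<Rightarrow> knot_group_element"
    and m n :: "nat \<Rightarrow> int"
    and d :: int
  assumes "surface_knot F\<^sub>0"
    and "tubular_framing F\<^sub>0 \<Phi>"
    and "x \<in> tube_boundary \<Phi> F\<^sub>0"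
    and "G = knot_group \<Phi> F\<^sub>0 x"
    and "P = peripheral_subgroup \<Phi> F\<^sub>0 x"
    and "\<And>j. j \<in> {1..g} \<Longrightarrow> h j \<in> double_cosets G P"
    and "\<And>j. j \<in> {1..g} \<Longrightarrow> \<gamma> j \<in> h j"
    and "H = normal_closure G
           {\<gamma> i \<otimes>\<^bsub>G\<^esub> \<gamma> j \<otimes>\<^bsub>G\<^esub> inv\<^bsub>G\<^esub> \<gamma> i \<otimes>\<^bsub>G\<^esub> inv\<^bsub>G\<^esub> \<gamma> j | i j. i \<in> {1..g} \<and> j \<in> {1..g}}"
    and "d = (GCD j\<in>{1..g}. m j)"
    and "d \<noteq> 0"
  shows "\<exists>k \<in> double_cosets G P. \<exists>\<eta> \<in> k. \<exists>n' :: nat \<Rightarrow> int.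
           \<eta> \<in> generate G (\<gamma> ` {1..g}) \<and>
           H #>\<^bsub>G\<^esub> \<eta> \<in> generate (G Mod H) ((\<lambda>j. H #>\<^bsub>G\<^esub> \<gamma> j) ` {1..g}) \<and>
           (\<forall>j\<in>{1..g}. n' j \<in> {0..d - 1}) \<and>
           deformed_by_handle_moves G
             ((\<Sum>j\<in>{1..g}. {#Handle (\<gamma> j) (m j) (n j)#}) + {#Handle \<one>\<^bsub>G\<^esub> 0 0#})
             ((\<Sum>j\<in>{1..g}. {#Handle (\<gamma> j) 0 (n' j)#})
               + {#Handle \<eta> d ((\<Sum>j\<in>{1..g}. m j * n j) div d)#})"
proof -
  have tube: "tube_boundary \<Phi> F\<^sub>0 \<subseteq> knot_exterior \<Phi> F\<^sub>0"
    using assms(2) by (rule tube_boundary_subset_knot_exterior)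
  interpret group G
    unfolding assms(4) knot_group_def using tube assms(3)
    by (intro group_fundamental_group) blast
  have P: "P \<subseteq> carrier G" "\<one>\<^bsub>G\<^esub> \<in> P"
    unfolding assms(4,5) using peripheral_subgroup_subset[OF tube] assms(3)
    by (auto intro: one_in_peripheral_subgroup)
  have \<gamma>: "\<gamma> j \<in> carrier G" if "j \<in> {1..g}" for j
    using double_coset_subset_carrier[OF P(1) assms(6)[OF that]] assms(7)[OF that] by blast
  have H: "H \<lhd> G"
    unfolding assms(8) using \<gamma> by (intro normal_normal_closure) auto
  obtain \<eta> where \<eta>: "\<eta> \<in> generate G (\<gamma> ` {1..g})" and deformed: "deformed_by_handle_moves G
      ((\<Sum>j\<in>{1..g}. {#Handle (\<gamma> j) (m j) (n j)#}) + {#Handle \<one>\<^bsub>G\<^esub> 0 0#})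
      ((\<Sum>j\<in>{1..g}. {#Handle (\<gamma> j) 0 (n j mod d)#})
        + {#Handle \<eta> d ((\<Sum>j\<in>{1..g}. m j * n j) div d)#})"
    using deformed_to_gcd_handle[of "{1..g}" \<gamma> d m n] \<gamma> assms(9) by auto
  have \<eta>_carrier: "\<eta> \<in> carrier G"
    using generate_in_carrier[OF _ \<eta>] \<gamma> by blast
  \<comment> \<open>A gcd of integers is nonnegative. Positivity places the remainders in
    \<open>{0..d - 1}\<close>.\<close>
  have "d > 0"
    using assms(9,10) by (simp add: order_less_le)
  then have mod: "\<forall>j\<in>{1..g}. n j mod d \<in> {0..d - 1}"
    by simp
  have coset: "H #>\<^bsub>G\<^esub> \<eta> \<in> generate (G Mod H) ((\<lambda>j. H #>\<^bsub>G\<^esub> \<gamma> j) ` {1..g})"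
    using r_coset_in_generate_Mod[OF H image_subsetI[OF \<gamma>] \<eta>] by (simp add: image_image)
  \<comment> \<open>The 1-handle \<open>k\<close> is the double coset of \<eta>, which contains
    \<eta> because the unit lies in \<open>P\<close>.\<close>
  have "P <#>\<^bsub>G\<^esub> (\<eta> <#\<^bsub>G\<^esub> P) \<in> double_cosets G P"
    using \<eta>_carrier by (simp add: double_cosets_def)
  then show ?thesis
    using mem_own_double_coset[OF P(2) \<eta>_carrier] \<eta> coset mod deformed
    by (intro bexI[of _ "P <#>\<^bsub>G\<^esub> (\<eta> <#\<^bsub>G\<^esub> P)"] bexI[of _ \<eta>] exI[of _ "\<lambda>j. n j mod d"]) auto
qed

end
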